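(* Let $A=\{1,a_2,a_3,\ldots\}$ be a (finite or infinite) set of positive integers with $1<a_2<a_3<\cdots$ such that $a_k-a_l\geqslant a_3$ for every $k>l\geqslant 3$. Then $$p_A(w\mid\text{no } a_2\text{'s})\;p_A(z)\;\geqslant\; p_A(w+z\mid \text{no } a_2\text{'s})$$ for all positive integers $w\geqslant a_3+1$ and $z\geqslant 2a_2$.
   Context: For a set $A$ of positive integers, an $A$-partition of $n$ is a partition of $n$ all of whose parts belong to $A$, and $p_A(n)$ denotes the number of $A$-partitions of $n$. The quantity $p_A(n\mid\text{no } a_2\text{'s})$ denotes the number of $A$-partitions of $n$ in which $a_2$ does not occur as a part. *)

theory Defs
  imports "HOL-Library.Multiset"
begin

text \<open>A partition is encoded as the multiset of its (positive) parts.\<close>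

definition partitions :: "nat \<Rightarrow> nat multiset set" where
  "partitions n = {P. 0 \<notin># P \<and> sum_mset P = n}"

definition A_partitions :: "nat set \<Rightarrow> nat \<Rightarrow> nat multiset set" where
  "A_partitions A n = {P \<in> partitions n. set_mset P \<subseteq> A}"

definition p_A :: "nat set \<Rightarrow> nat \<Rightarrow> nat" where
  "p_A A n = card (A_partitions A n)"

definition p_A_no :: "nat set \<Rightarrow> nat \<Rightarrow> nat \<Rightarrow> nat" where
  "p_A_no A b n = card {P \<in> A_partitions A n. b \<notin># P}"

text \<open>The two cardinalities count finite sets, so the convention that infinite sets have
  cardinality 0 does not interfere.\<close>

lemma finite_partitions: "finite (partitions n)"
proof (rule finite_subset)
  show "partitions n \<subseteq> mset ` {xs. set xs \<subseteq> {..n} \<and> length xs \<le> n}"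
  proof
    fix P assume "P \<in> partitions n"
    then have P: "0 \<notin># P" "sum_mset P = n"
      by (auto simp: partitions_def)
    obtain xs where xs: "mset xs = P"
      using ex_mset by blast
    have "length xs \<le> sum_list xs" if "0 \<notin> set xs" for xs :: "nat list"
      using that by (induction xs) auto
    moreover have "sum_list xs = n" "0 \<notin> set xs"
      using P xs by (auto simp: sum_mset_sum_list[symmetric])
    moreover have "set xs \<subseteq> {..n}"
      using \<open>sum_list xs = n\<close> member_le_sum_list by fastforce
    ultimately show "P \<in> mset ` {xs. set xs \<subseteq> {..n} \<and> length xs \<le> n}"
      using xs by fastforce
  qed
  show "finite (mset ` {xs. set xs \<subseteq> {..n} \<and> length xs \<le> n})"
    by (intro finite_imageI finite_lists_length_le) simp
qed

lemma finite_A_partitions: "finite (A_partitions A n)"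
  by (rule finite_subset[OF _ finite_partitions[of n]]) (auto simp: A_partitions_def)

end

theory Submission
  imports Defs
begin

text \<open>
  Write \<open>b = a 3\<close>, \<open>m = a 2\<close> and \<open>C = {a 3, a 4, \<dots>}\<close>. Deleting the ones turns partitions of \<open>n\<close> into
  multisets of sum at most \<open>n\<close>, so it suffices to inject the multisets \<open>M\<close> over \<open>C\<close> of sum at most
  \<open>w + z\<close> into the pairs of a multiset over \<open>C\<close> of sum at most \<open>w\<close> and one over \<open>C \<union> {m}\<close> of sum at
  most \<open>z\<close>. Fill \<open>w\<close> with the parts of \<open>M\<close>, largest first. If the remaining parts fit into \<open>z\<close>, we
  are done without using \<open>m\<close>. Otherwise \<open>M\<close> consists of the parts \<open>L\<close> placed so far, a part \<open>c\<close> that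
  fits on neither side, and parts \<open>R\<close> of size at most \<open>c\<close>. If \<open>W\<close> and \<open>Z\<close> are the free amounts on the two sides,
  then \<open>max W Z < c \<le> W + Z\<close>; as elements of \<open>C\<close> are at least \<open>b\<close> apart, \<open>c\<close> is determined by \<open>L\<close>,
  \<open>R\<close> and an index \<open>i\<close> with \<open>i * b < min W Z\<close>. This index is recorded as \<open>i\<close> extra copies of \<open>b\<close> on
  the left, and an \<open>m\<close> on the right marks the case. When \<open>Z < m\<close> leaves no room for \<open>m\<close>, the index
  is 0, and other unused pairs serve as codes.
\<close>

section \<open>Deletion of the parts equal to 1\<close>

definition bounded_msets :: "nat set \<Rightarrow> nat \<Rightarrow> nat multiset set" where
  "bounded_msets D n = {M. set_mset M \<subseteq> D \<and> sum_mset M \<le> n}"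

text \<open>The inverse deletes the ones; their number is the amount missing from \<open>n\<close>,
  a subtraction that does not truncate because \<open>sum_mset M \<le> n\<close>.\<close>

lemma bij_betw_bounded_msets_A_partitions:
  assumes "0 \<notin> D" "1 \<notin> D"
  shows "bij_betw (\<lambda>M. M + replicate_mset (n - sum_mset M) 1)
           (bounded_msets D n) (A_partitions (insert 1 D) n)"
proof (rule bij_betw_byWitness[where f' = "filter_mset (\<lambda>x. x \<noteq> 1)"])
  have split: "P = filter_mset (\<lambda>x. x \<noteq> 1) P + replicate_mset (count P 1) 1" for P :: "nat multiset"
    by (metis filter_eq_replicate_mset multiset_partition add.commute)
  have sum_split: "sum_mset P = sum_mset (filter_mset (\<lambda>x. x \<noteq> 1) P) + count P 1" for P :: "nat multiset"
    using arg_cong[OF split[of P], of sum_mset] by (simp add: sum_mset_replicate_mset)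
  show "\<forall>M\<in>bounded_msets D n. filter_mset (\<lambda>x. x \<noteq> 1) (M + replicate_mset (n - sum_mset M) 1) = M"
  proof
    fix M assume M: "M \<in> bounded_msets D n"
    then have "filter_mset (\<lambda>x. x \<noteq> 1) M = M"
      using assms by (auto simp: bounded_msets_def filter_mset_eq_conv)
    moreover have "filter_mset (\<lambda>x. x \<noteq> 1) (replicate_mset k (1::nat)) = {#}" for k
      by (induction k) auto
    ultimately show "filter_mset (\<lambda>x. x \<noteq> 1) (M + replicate_mset (n - sum_mset M) 1) = M"
      by simp
  qed
  show "\<forall>P\<in>A_partitions (insert 1 D) n. filter_mset (\<lambda>x. x \<noteq> 1) P +
          replicate_mset (n - sum_mset (filter_mset (\<lambda>x. x \<noteq> 1) P)) 1 = P"
  proof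
    fix P assume "P \<in> A_partitions (insert 1 D) n"
    then have "n = sum_mset P"
      by (auto simp: A_partitions_def partitions_def)
    then have "n - sum_mset (filter_mset (\<lambda>x. x \<noteq> 1) P) = count P 1"
      using sum_split[of P] by linarith
    then show "filter_mset (\<lambda>x. x \<noteq> 1) P +
          replicate_mset (n - sum_mset (filter_mset (\<lambda>x. x \<noteq> 1) P)) 1 = P"
      using split[of P] by simp
  qed
  show "(\<lambda>M. M + replicate_mset (n - sum_mset M) 1) ` bounded_msets D n \<subseteq> A_partitions (insert 1 D) n"
    using assms
    by (auto simp: bounded_msets_def A_partitions_def partitions_def sum_mset_replicate_mset
        split: if_splits)
  show "filter_mset (\<lambda>x. x \<noteq> 1) ` A_partitions (insert 1 D) n \<subseteq> bounded_msets D n"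
  proof (rule image_subsetI)
    fix P assume "P \<in> A_partitions (insert 1 D) n"
    then show "filter_mset (\<lambda>x. x \<noteq> 1) P \<in> bounded_msets D n"
      using sum_split[of P]
      by (auto simp: bounded_msets_def A_partitions_def partitions_def)
  qed
qed

lemma
  assumes "0 \<notin> D" "1 \<notin> D"
  shows p_A_insert_1: "p_A (insert 1 D) n = card (bounded_msets D n)"
    and finite_bounded_msets: "finite (bounded_msets D n)"
  using bij_betw_bounded_msets_A_partitions[OF assms, of n] finite_A_partitions[of "insert 1 D" n]
  unfolding p_A_def by (metis bij_betw_same_card, metis bij_betw_finite)

lemma p_A_no_eq_p_A_Diff: "p_A_no A b n = p_A (A - {b}) n"
proof -
  have "{P \<in> A_partitions A n. b \<notin># P} = A_partitions (A - {b}) n"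
    by (auto simp: A_partitions_def)
  then show ?thesis
    by (simp add: p_A_no_def p_A_def)
qed

section \<open>Largest-first filling and its codes\<close>

definition straddles :: "nat \<Rightarrow> nat \<Rightarrow> nat multiset \<Rightarrow> nat \<Rightarrow> nat multiset \<Rightarrow> bool" where
  "straddles w z L c R \<longleftrightarrow>
     sum_mset L \<le> w \<and> w < sum_mset L + c \<and> sum_mset R \<le> z \<and> z < sum_mset R + c \<and>
     sum_mset L + c + sum_mset R \<le> w + z \<and> (\<forall>u\<in>#L. c \<le> u) \<and> (\<forall>v\<in>#R. v \<le> c)"

text \<open>Cut the numbers exceeding both free amounts into consecutive blocks of length
  \<open>b\<close>, numbered from 0. This is the index of the block containing \<open>c\<close>;
  numbers at least \<open>b\<close> apart lie in different blocks.\<close>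

definition slot :: "nat \<Rightarrow> nat \<Rightarrow> nat \<Rightarrow> nat multiset \<Rightarrow> nat \<Rightarrow> nat multiset \<Rightarrow> nat" where
  "slot b w z L c R = (c - max (w - sum_mset L) (z - sum_mset R) - 1) div b"

text \<open>In \<open>tight_least\<close> the multiset \<open>R\<close> need not be stored: it consists of \<open>z div b\<close> copies of \<open>b\<close>. In
  \<open>tight\<close> the part \<open>b\<close> on the left is smaller than a part on the right, which never happens in
  \<open>fits\<close>.\<close>

inductive encodes :: "nat \<Rightarrow> nat \<Rightarrow> nat \<Rightarrow> nat \<Rightarrow> nat multiset \<Rightarrow> nat multiset \<Rightarrow> nat multiset \<Rightarrow> bool"
  for b m w z where
  fits: "sum_mset x \<le> w \<Longrightarrow> sum_mset y \<le> z \<Longrightarrow> \<forall>u\<in>#x. \<forall>v\<in>#y. v \<le> u \<Longrightarrow>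
    encodes b m w z (x + y) x y"
| room: "straddles w z L c R \<Longrightarrow> m \<le> z - sum_mset R \<Longrightarrow>
    encodes b m w z (L + add_mset c R) (L + replicate_mset (slot b w z L c R) b) (add_mset m R)"
| tight_least: "straddles w z L c R \<Longrightarrow> z - sum_mset R < m \<Longrightarrow> \<forall>v\<in>#R. v = b \<Longrightarrow>
    encodes b m w z (L + add_mset c R) L {#m, m#}"
| tight: "straddles w z L c R \<Longrightarrow> z - sum_mset R < m \<Longrightarrow> v \<in># R \<Longrightarrow> b < v \<Longrightarrow>
    encodes b m w z (L + add_mset c R) (add_mset b L) R"

lemma sorted_split_cases:
  fixes M :: "nat multiset"
  assumes "sum_mset M \<le> w + z"
  obtains (fits) x y where "M = x + y" "sum_mset x \<le> w" "sum_mset y \<le> z" "\<forall>u\<in>#x. \<forall>v\<in>#y. v \<le> u"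
  | (splits) L c R where "M = L + add_mset c R" "straddles w z L c R"
proof -
  \<comment> \<open>A largest \<open>L\<close> satisfying \<open>P\<close> is where the
    largest-first filling of \<open>w\<close> stops.\<close>
  define P where "P L \<longleftrightarrow> L \<subseteq># M \<and> sum_mset L \<le> w \<and> (\<forall>u\<in>#L. \<forall>v\<in>#M - L. v \<le> u)" for L
  have "P {#}"
    by (simp add: P_def)
  moreover have "\<forall>L. P L \<longrightarrow> size L < Suc (size M)"
    by (auto simp: P_def size_mset_mono less_Suc_eq_le)
  ultimately obtain L where L: "P L" and maxL: "\<And>L'. P L' \<Longrightarrow> size L' \<le> size L"
    using ex_has_greatest_nat[of P "{#}" size "Suc (size M)"] by auto
  define y where "y = M - L"
  have M: "M = L + y" and Lw: "sum_mset L \<le> w" and sorted: "\<forall>u\<in>#L. \<forall>v\<in>#y. v \<le> u"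
    using L by (auto simp: P_def y_def)
  show thesis
  proof (cases "sum_mset y \<le> z")
    case True
    then show thesis
      using that(1) M Lw sorted by blast
  next
    case False
    then have "y \<noteq> {#}"
      by auto
    define c where "c = Max_mset y"
    have c: "c \<in># y" "\<forall>v\<in>#y. v \<le> c"
      using \<open>y \<noteq> {#}\<close> by (simp_all add: c_def)
    obtain R where R: "y = add_mset c R"
      using c(1) by (meson multi_member_split)
    have "\<not> P (add_mset c L)"
      using maxL[of "add_mset c L"] by auto
    then have "w < sum_mset L + c"
      using c sorted by (auto simp: P_def M R)
    \<comment> \<open>As \<open>L\<close> and \<open>c\<close> together exceed \<open>w\<close>, the
      bound on the total leaves at most \<open>z\<close> for \<open>R\<close>.\<close>
    then have "straddles w z L c R"
      using False Lw assms c sorted by (auto simp: straddles_def M R)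
    then show thesis
      using that(2) M R by blast
  qed
qed

section \<open>Existence and injectivity of codes for spaced parts\<close>

locale spaced_parts =
  fixes C :: "nat set" and b m :: nat
  assumes b_in: "b \<in> C"
    and b_least: "c \<in> C \<Longrightarrow> b \<le> c"
    and spaced: "c \<in> C \<Longrightarrow> d \<in> C \<Longrightarrow> c < d \<Longrightarrow> c + b \<le> d"
    and m_less: "m < b"
begin

lemma m_notin: "m \<notin> C"
  using b_least[of m] m_less by linarith

text \<open>Since \<open>c\<close> is at most the sum of the two free amounts, its excess over the
  larger one is at most the smaller one; the 1 subtracted in \<open>slot\<close> makes the bounds
  strict.\<close>

lemma slot_bound:
  assumes "straddles w z L c R"
  shows "slot b w z L c R * b < w - sum_mset L" "slot b w z L c R * b < z - sum_mset R"
proof -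
  have "slot b w z L c R * b \<le> c - max (w - sum_mset L) (z - sum_mset R) - 1"
    unfolding slot_def by (metis div_times_less_eq_dividend)
  then show "slot b w z L c R * b < w - sum_mset L" "slot b w z L c R * b < z - sum_mset R"
    using assms by (auto simp: straddles_def max_def split: if_splits)
qed

lemma straddles_unique:
  assumes "straddles w z L c R" "straddles w z L d R" "c \<in> C" "d \<in> C"
    "slot b w z L c R = slot b w z L d R"
  shows "c = d"
proof -
  have b: "0 < b"
    using m_less by simp
  have False if cd: "straddles w z L c R" "straddles w z L d R" "c \<in> C" "d \<in> C"
    "slot b w z L c R = slot b w z L d R" "c < d" for c d
  proof -
    let ?k = "max (w - sum_mset L) (z - sum_mset R) + 1"
    have "?k \<le> c"
      using cd(1) by (auto simp: straddles_def)
    then have "c - ?k + b \<le> d - ?k"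
      using spaced[OF cd(3,4,6)] by linarith
    then have "(c - ?k + b) div b \<le> (d - ?k) div b"
      by (rule div_le_mono)
    then show False
      using cd(5) div_add_self2[of b "c - ?k"] b by (simp add: slot_def)
  qed
  then show ?thesis
    using assms by (metis nat_neq_iff)
qed

lemma tight_slot:
  assumes "straddles w z L c R" "z - sum_mset R < m"
  shows "slot b w z L c R = 0"
proof -
  have "slot b w z L c R * b < b"
    using slot_bound(2)[OF assms(1)] assms(2) m_less by linarith
  then show ?thesis
    by simp
qed

lemma encodes_exists:
  assumes M: "M \<in> bounded_msets C (w + z)" and z: "2 * m \<le> z"
  shows "\<exists>x\<in>bounded_msets C w. \<exists>y\<in>bounded_msets (insert m C) z. encodes b m w z M x y"
proof -
  have sum_M: "sum_mset M \<le> w + z" and MC: "set_mset M \<subseteq> C"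
    using M by (auto simp: bounded_msets_def)
  from sum_M show ?thesis
  proof (cases rule: sorted_split_cases)
    case (fits x y)
    then show ?thesis
      using MC by (intro bexI[of _ x] bexI[of _ y]) (auto simp: bounded_msets_def intro: encodes.fits)
  next
    case (splits L c R)
    note s = \<open>straddles w z L c R\<close>[unfolded straddles_def]
    have LC: "set_mset L \<subseteq> C" and RC: "set_mset R \<subseteq> C" and cC: "c \<in> C"
      using MC splits(1) by auto
    consider "m \<le> z - sum_mset R" | "z - sum_mset R < m" "\<forall>v\<in>#R. v = b"
      | v where "z - sum_mset R < m" "v \<in># R" "b < v"
      using RC b_least by (metis leI le_neq_implies_less subsetD)
    then show ?thesis
    proof cases
      case 1
      have "L + replicate_mset (slot b w z L c R) b \<in> bounded_msets C w"
        using slot_bound(1)[OF splits(2)] LC b_in s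
        by (auto simp: bounded_msets_def sum_mset_replicate_mset split: if_splits)
      moreover have "add_mset m R \<in> bounded_msets (insert m C) z"
        using 1 RC s by (auto simp: bounded_msets_def)
      ultimately show ?thesis
        using encodes.room[OF splits(2) 1] splits(1) by blast
    next
      case 2
      \<comment> \<open>The two copies of \<open>m\<close> fit on the right because
        \<open>2 * m \<le> z\<close>.\<close>
      have "L \<in> bounded_msets C w" "{#m, m#} \<in> bounded_msets (insert m C) z"
        using LC s z by (auto simp: bounded_msets_def)
      then show ?thesis
        using encodes.tight_least[OF splits(2) 2] splits(1) by blast
    next
      case 3
      \<comment> \<open>The aim is room for \<open>b\<close> on the left:
        \<open>c \<ge> 2 * b\<close>, while less than \<open>m < b\<close> is free on the right, so
        more than \<open>b\<close> is free on the left.\<close>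
      have "b < c"
        using 3 s by force
      then have "b + b \<le> c"
        using spaced b_in cC by blast
      then have "add_mset b L \<in> bounded_msets C w"
        using LC b_in s 3(1) m_less by (auto simp: bounded_msets_def)
      moreover have "R \<in> bounded_msets (insert m C) z"
        using RC s by (auto simp: bounded_msets_def)
      ultimately show ?thesis
        using encodes.tight[OF splits(2) 3] splits(1) by blast
    qed
  qed
qed

text \<open>Copies of \<open>b\<close> recording the index might be confused with parts
  \<open>b\<close> of \<open>L\<close>. But a part \<open>b\<close> in \<open>L\<close> forces
  \<open>c \<le> b\<close>, so less than \<open>b\<close> is free on the right, whereas a positive
  index requires more than \<open>b\<close> there.\<close>

lemma room_slot_le:
  assumes c: "straddles w z L c R" "c \<in> C" "set_mset L \<subseteq> C"
    and d: "straddles w z K d R" "d \<in> C" "set_mset K \<subseteq> C"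
    and eq: "L + replicate_mset (slot b w z L c R) b = K + replicate_mset (slot b w z K d R) b"
  shows "slot b w z K d R \<le> slot b w z L c R"
proof (rule ccontr)
  let ?i = "slot b w z L c R" and ?j = "slot b w z K d R"
  assume "\<not> ?j \<le> ?i"
  then have less: "?i < ?j"
    by simp
  then have "1 * b \<le> ?j * b"
    by (intro mult_right_mono) auto
  then have bz: "b < z - sum_mset R"
    using slot_bound(2)[OF d(1)] by linarith
  have "count L b + ?i = count K b + ?j"
    using arg_cong[OF eq, of "\<lambda>M. count M b"] by simp
  then have "b \<in># L"
    using less by (metis add_less_cancel_left count_inI less_add_eq_less not_add_less2 add.commute add_0)
  then have "c \<le> b"
    using c(1) by (auto simp: straddles_def)
  then show False
    using c(1) bz by (auto simp: straddles_def)
qed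

lemma room_inject:
  assumes c: "straddles w z L c R" "c \<in> C" "set_mset L \<subseteq> C"
    and d: "straddles w z K d R" "d \<in> C" "set_mset K \<subseteq> C"
    and eq: "L + replicate_mset (slot b w z L c R) b = K + replicate_mset (slot b w z K d R) b"
  shows "L = K \<and> c = d"
proof -
  have slots: "slot b w z L c R = slot b w z K d R"
    using room_slot_le[OF c d eq] room_slot_le[OF d c eq[symmetric]] by simp
  then have "L = K"
    using eq by simp
  then show ?thesis
    using straddles_unique c d slots by metis
qed

lemma tight_least_inject:
  assumes c: "straddles w z L c R" "z - sum_mset R < m" "\<forall>v\<in>#R. v = b" "c \<in> C"
    and d: "straddles w z L d S" "z - sum_mset S < m" "\<forall>v\<in>#S. v = b" "d \<in> C"
  shows "c = d \<and> R = S"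
proof -
  have rep: "M = replicate_mset (z div b) b"
    if "\<forall>v\<in>#M. v = b" "sum_mset M \<le> z" "z - sum_mset M < m" for M
  proof -
    have M: "M = replicate_mset (size M) b"
      using that(1) by (metis set_mset_subset_singletonD singletonI subsetI insertCI singleton_iff)
    have "sum_mset M = size M * b"
      by (subst M) (simp add: sum_mset_replicate_mset)
    \<comment> \<open>The remainder \<open>z - sum_mset M\<close> is below \<open>m\<close>, hence
      below \<open>b\<close>.\<close>
    then have "z div b = size M"
      using that m_less by (intro div_nat_eqI) (auto simp: algebra_simps)
    then show ?thesis
      using M by simp
  qed
  have "R = S"
    using rep[OF c(3) _ c(2)] rep[OF d(3) _ d(2)] c(1) d(1) unfolding straddles_def by metis
  then show ?thesis
    using straddles_unique[of w z L c R d] tight_slot[of w z L c R] tight_slot[of w z L d R] c d by simp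
qed

text \<open>As \<open>m\<close> is not in \<open>C\<close>, the right side contains it 0, 1, 2, 0
  times in the four cases, in the order of the rules. Only \<open>fits\<close> and
  \<open>tight\<close> agree, and the order of parts across the two sides separates them.\<close>

lemma encodes_inject:
  assumes "encodes b m w z M x y" "encodes b m w z N x y" "set_mset M \<subseteq> C" "set_mset N \<subseteq> C"
  shows "M = N"
proof -
  from assms(1) show ?thesis
  proof cases
    case fits
    from assms(2) show ?thesis
      by cases (use fits assms(3,4) m_notin in \<open>auto simp: leD\<close>)
  next
    case 1: (room L c R)
    from assms(2) show ?thesis
    proof cases
      case (room K d S)
      then show ?thesis
        using 1 room_inject[of w z L c R K d] assms(3,4) by auto
    qed (use 1 assms(3,4) m_notin in auto)
  next
    case 1: (tight_least c R)
    from assms(2) show ?thesis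
    proof cases
      case (tight_least d S)
      then show ?thesis
        using 1 tight_least_inject[of w z x c R d S] assms(3,4) by auto
    qed (use 1 assms(3,4) m_notin in auto)
  next
    case 1: (tight L c v)
    from assms(2) show ?thesis
    proof cases
      case fits
      then show ?thesis
        using 1 by (auto simp: leD)
    next
      case (tight K d v')
      then show ?thesis
        using 1 assms(3,4) straddles_unique[of w z L c y d] tight_slot by auto
    qed (use 1 assms(3,4) m_notin in auto)
  qed
qed

lemma card_bounded_msets_add_le:
  assumes "1 < m" "2 * m \<le> z"
  shows "card (bounded_msets C (w + z)) \<le> card (bounded_msets C w) * card (bounded_msets (insert m C) z)"
proof -
  have C: "0 \<notin> C" "1 \<notin> C"
    using b_least m_less assms(1) by force+
  have "\<forall>M\<in>bounded_msets C (w + z). \<exists>p. p \<in> bounded_msets C w \<times> bounded_msets (insert m C) z \<and>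
          encodes b m w z M (fst p) (snd p)"
    using encodes_exists[OF _ assms(2)] by force
  \<comment> \<open>A multiset might have several codes; choosing one suffices, since each code
    determines its multiset.\<close>
  then obtain f where f: "\<And>M. M \<in> bounded_msets C (w + z) \<Longrightarrow>
      f M \<in> bounded_msets C w \<times> bounded_msets (insert m C) z \<and>
      encodes b m w z M (fst (f M)) (snd (f M))"
    by metis
  have "inj_on f (bounded_msets C (w + z))"
    by (rule inj_onI) (metis (no_types, lifting) f encodes_inject bounded_msets_def mem_Collect_eq)
  moreover have "f ` bounded_msets C (w + z) \<subseteq> bounded_msets C w \<times> bounded_msets (insert m C) z"
    using f by blast
  moreover have "finite (bounded_msets C w \<times> bounded_msets (insert m C) z)"
    using C assms(1) by (intro finite_cartesian_product finite_bounded_msets) auto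
  ultimately show ?thesis
    using card_inj_on_le[of f] by (metis card_cartesian_product)
qed

end

section \<open>Return to partition counts\<close>

theorem theorem3p1:
  fixes a :: "nat \<Rightarrow> nat" and I A :: "nat set" and w z :: nat
  assumes I: "I = {1..} \<or> (\<exists>m\<ge>3. I = {1..m})"
    and A: "A = a ` I"
    and a1: "a 1 = 1"
    and mono: "strict_mono_on I a"
    and gap: "\<And>k l. k \<in> I \<Longrightarrow> l \<in> I \<Longrightarrow> k > l \<Longrightarrow> l \<ge> 3 \<Longrightarrow> int (a k) - int (a l) \<ge> int (a 3)"
    and w: "w \<ge> a 3 + 1"
    and z: "z \<ge> 2 * a 2"
  shows "p_A_no A (a 2) w * p_A A z \<ge> p_A_no A (a 2) (w + z)"
proof -
  define C where "C = a ` (I \<inter> {3..})"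
  have I3: "1 \<in> I" "2 \<in> I" "3 \<in> I" and I_ge: "\<And>k. k \<in> I \<Longrightarrow> 1 \<le> k"
    using I by auto
  have a12: "1 < a 2" and a23: "a 2 < a 3"
    using strict_mono_onD[OF mono, of 1 2] strict_mono_onD[OF mono, of 2 3] I3 a1 by auto
  interpret spaced_parts C "a 3" "a 2"
  proof
    show "a 3 \<in> C"
      using I3 by (auto simp: C_def)
    show "a 3 \<le> c" if "c \<in> C" for c
      using that I3 strict_mono_on_leD[OF mono] by (auto simp: C_def)
    show "c + a 3 \<le> d" if cd: "c \<in> C" "d \<in> C" "c < d" for c d
    proof -
      obtain l k where lk: "l \<in> I" "3 \<le> l" "c = a l" "k \<in> I" "3 \<le> k" "d = a k"
        using cd by (auto simp: C_def)
      then have "l < k"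
        using cd(3) strict_mono_on_leD[OF mono, of k l] by (meson leD leI)
      then show ?thesis
        using gap[of k l] lk by auto
    qed
    show "a 2 < a 3"
      by (rule a23)
  qed
  have "I = insert 1 (insert 2 (I \<inter> {3..}))"
    using I3 I_ge by (auto simp: numeral_eq_Suc not_less_eq_eq intro: le_antisym)
  then have A_eq: "A = insert 1 (insert (a 2) C)"
    unfolding A C_def using a1 by (metis image_insert)
  then have A_diff: "A - {a 2} = insert 1 C"
    using m_notin a12 by auto
  have "0 \<notin> C" "1 \<notin> C"
    using b_least a12 a23 by force+
  then have "p_A_no A (a 2) n = card (bounded_msets C n)"
    and "p_A A n = card (bounded_msets (insert (a 2) C) n)" for n
    using p_A_insert_1[of C n] p_A_insert_1[of "insert (a 2) C" n] a12
    unfolding p_A_no_eq_p_A_Diff A_diff by (simp_all add: A_eq)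
  then show ?thesis
    using card_bounded_msets_add_le[OF a12 z] by simp
qed

end
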